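(* Let $f_1,\dots,f_5,g_1,\dots,g_5,h$ be nonzero linear forms on $\mathbb{P}^4$ with $h=f_i+g_i$ for $i=1,\dots,5$, let $F_i=(f_i=0)$, $G_j=(g_j=0)$, and suppose that each $\Pi_{ij}=F_i\cap G_j$ ($1\le i,j\le 5$) is a plane (so that the five diagonal planes $\Pi_{11},\dots,\Pi_{55}$ lie in the hyperplane $H=(h=0)$). Then the associated quartic Pascal threefold $$X=\left(\frac{f_1f_2f_3f_4f_5+g_1g_2g_3g_4g_5}{h}=0\right)\subset\mathbb{P}^4$$ contains the twenty residual planes $\Pi_{ij}=F_i\cap G_j$, $i\neq j$, $1\le i,j\le 5$.
   Context: We work over $\mathbb{C}$. The setting is two quintuples of hyperplanes $F_1,\dots,F_5$ and $G_1,\dots,G_5$ in $\mathbb{P}^4$ such that the five diagonal planes $\Pi_{ii}=F_i\cap G_i$ are contained in a common hyperplane $H=(h=0)$; the equations are rescaled so that $h=f_i+g_i$ for all $i$. Since $g_i=h-f_i$, the form $f_1\cdots f_5+g_1\cdots g_5$ is divisible by $h$, so the quotient is a form of degree $4$; $X$ denotes its zero locus. *)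

theory Defs
  imports "HOL-Analysis.Analysis" "HOL-Library.Poly_Mapping"
begin

text \<open>
  The homogeneous coordinate ring of four-dimensional projective space: polynomials in five
  variables over the complex numbers, with a monomial encoded by its exponent vector.
  The ring structure is the convolution product of \<^theory>\<open>HOL-Library.Poly_Mapping\<close>.
\<close>

type_synonym cpoly5 = "(5 \<Rightarrow>\<^sub>0 nat) \<Rightarrow>\<^sub>0 complex"

definition monom_deg :: "(5 \<Rightarrow>\<^sub>0 nat) \<Rightarrow> nat" where
  "monom_deg m = (\<Sum>i\<in>UNIV. Poly_Mapping.lookup m i)"

text \<open>As usual, the zero polynomial counts as a form of every degree.\<close>

definition is_form :: "nat \<Rightarrow> cpoly5 \<Rightarrow> bool" where
  "is_form d p \<longleftrightarrow> (\<forall>m\<in>Poly_Mapping.keys p. monom_deg m = d)"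

definition eval_poly :: "cpoly5 \<Rightarrow> complex ^ 5 \<Rightarrow> complex" where
  "eval_poly p x =
    (\<Sum>m\<in>Poly_Mapping.keys p. Poly_Mapping.lookup p m * (\<Prod>i\<in>UNIV. (x $ i) ^ Poly_Mapping.lookup m i))"

text \<open>A point of projective space is a complex line through the origin.\<close>

definition proj4 :: "(complex ^ 5) set set" where
  "proj4 = {vec.span {v} | v. v \<noteq> 0}"

text \<open>
  A form vanishes on the whole line as soon as it vanishes at one nonzero vector of it, so for
  forms this is the usual zero locus; see \<open>span_mem_zero_locus_iff\<close> below.
\<close>

definition zero_locus :: "cpoly5 \<Rightarrow> (complex ^ 5) set set" where
  "zero_locus p = {L \<in> proj4. \<forall>v\<in>L. eval_poly p v = 0}"

text \<open>A projective plane comes from a linear subspace of vector space dimension three.\<close>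

definition is_plane :: "(complex ^ 5) set set \<Rightarrow> bool" where
  "is_plane S \<longleftrightarrow> (\<exists>W. vec.subspace W \<and> vec.dim W = 3 \<and> S = {L \<in> proj4. L \<subseteq> W})"

definition Pi_plane ::
  "(nat \<Rightarrow> cpoly5) \<Rightarrow> (nat \<Rightarrow> cpoly5) \<Rightarrow> nat \<Rightarrow> nat \<Rightarrow> (complex ^ 5) set set" where
  "Pi_plane f g i j = zero_locus (f i) \<inter> zero_locus (g j)"

text \<open>
  The exact quotient in the polynomial ring.  The lemmas \<open>pascal_quartic_mult\<close> and
  \<open>is_form_pascal_quartic\<close> below show that it exists and is a form of degree four.
\<close>

definition pascal_quartic :: "(nat \<Rightarrow> cpoly5) \<Rightarrow> (nat \<Rightarrow> cpoly5) \<Rightarrow> cpoly5 \<Rightarrow> cpoly5" where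
  "pascal_quartic f g h = (THE q. h * q = (\<Prod>i=1..5. f i) + (\<Prod>i=1..5. g i))"

definition pascal_threefold ::
  "(nat \<Rightarrow> cpoly5) \<Rightarrow> (nat \<Rightarrow> cpoly5) \<Rightarrow> cpoly5 \<Rightarrow> (complex ^ 5) set set" where
  "pascal_threefold f g h = zero_locus (pascal_quartic f g h)"

lemma prod_1_5: "(\<Prod>i=1..5::nat. f i) = f 1 * f 2 * f 3 * f 4 * (f 5 :: 'a :: comm_monoid_mult)"
proof -
  have "{1..5::nat} = {1, 2, 3, 4, 5}"
    by auto
  then show ?thesis
    by (simp add: mult.assoc)
qed

lemma pascal_quartic_eqI:
  assumes "h \<noteq> 0" and "h * q = (\<Prod>i=1..5. f i) + (\<Prod>i=1..5. g i)"
  shows "pascal_quartic f g h = q"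
  unfolding pascal_quartic_def
proof (rule the_equality)
  fix q' assume "h * q' = (\<Prod>i=1..5. f i) + (\<Prod>i=1..5. g i)"
  with assms show "q' = q"
    by (metis mult_left_cancel)
qed (rule assms)

lemma pascal_quartic_explicit:
  fixes f g :: "nat \<Rightarrow> cpoly5"
  assumes "h \<noteq> 0" and eq: "\<And>i. i \<in> {1..5} \<Longrightarrow> h = f i + g i"
  shows "pascal_quartic f g h =
    g 2 * g 3 * g 4 * g 5 - f 1 * g 3 * g 4 * g 5 + f 1 * f 2 * g 4 * g 5
      - f 1 * f 2 * f 3 * g 5 + f 1 * f 2 * f 3 * f 4"
proof (rule pascal_quartic_eqI)
  have g: "g 1 = h - f 1" "g 2 = h - f 2" "g 3 = h - f 3" "g 4 = h - f 4" "g 5 = h - f 5"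
    using eq[of 1] eq[of 2] eq[of 3] eq[of 4] eq[of 5] by (simp_all add: algebra_simps)
  show "h * (g 2 * g 3 * g 4 * g 5 - f 1 * g 3 * g 4 * g 5 + f 1 * f 2 * g 4 * g 5
      - f 1 * f 2 * f 3 * g 5 + f 1 * f 2 * f 3 * f 4) = (\<Prod>i=1..5. f i) + (\<Prod>i=1..5. g i)"
    unfolding prod_1_5 g by algebra
qed (rule assms)

lemma pascal_quartic_mult:
  fixes f g :: "nat \<Rightarrow> cpoly5"
  assumes "h \<noteq> 0" and eq: "\<And>i. i \<in> {1..5} \<Longrightarrow> h = f i + g i"
  shows "h * pascal_quartic f g h = (\<Prod>i=1..5. f i) + (\<Prod>i=1..5. g i)"
proof -
  have g: "g 1 = h - f 1" "g 2 = h - f 2" "g 3 = h - f 3" "g 4 = h - f 4" "g 5 = h - f 5"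
    using eq[of 1] eq[of 2] eq[of 3] eq[of 4] eq[of 5] by (simp_all add: algebra_simps)
  have "pascal_quartic f g h =
    g 2 * g 3 * g 4 * g 5 - f 1 * g 3 * g 4 * g 5 + f 1 * f 2 * g 4 * g 5
      - f 1 * f 2 * f 3 * g 5 + f 1 * f 2 * f 3 * f 4"
    by (rule pascal_quartic_explicit) (fact assms)+
  then show ?thesis
    unfolding prod_1_5 g by algebra
qed

lemma eval_poly_scale:
  assumes "is_form d p"
  shows "eval_poly p (c *s x) = c ^ d * eval_poly p x"
proof -
  have "(\<Prod>i\<in>UNIV. ((c *s x) $ i) ^ Poly_Mapping.lookup m i) =
      c ^ d * (\<Prod>i\<in>UNIV. (x $ i) ^ Poly_Mapping.lookup m i)"
    if "m \<in> Poly_Mapping.keys p" for m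
  proof -
    have "(\<Sum>i\<in>UNIV. Poly_Mapping.lookup m i) = d"
      using that assms by (auto simp: is_form_def monom_deg_def)
    then show ?thesis
      by (simp add: power_mult_distrib prod.distrib flip: power_sum)
  qed
  then show ?thesis
    by (simp add: eval_poly_def sum_distrib_left mult.left_commute)
qed

lemma span_mem_zero_locus_iff:
  assumes "is_form d p" and "v \<noteq> 0"
  shows "vec.span {v} \<in> zero_locus p \<longleftrightarrow> eval_poly p v = 0"
proof -
  have "vec.span {v} \<in> proj4"
    using assms(2) by (auto simp: proj4_def)
  moreover have "v \<in> vec.span {v}"
    by (simp add: vec.span_base)
  ultimately show ?thesis
    by (auto simp: zero_locus_def vec.span_singleton eval_poly_scale[OF assms(1)])
qed

lemma is_form_mult:
  assumes "is_form a p" and "is_form b q"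
  shows "is_form (a + b) (p * q)"
  unfolding is_form_def
proof
  fix m assume "m \<in> Poly_Mapping.keys (p * q)"
  then obtain s t where "m = s + t" "s \<in> Poly_Mapping.keys p" "t \<in> Poly_Mapping.keys q"
    using keys_mult[of p q] by blast
  then show "monom_deg m = a + b"
    using assms by (auto simp: is_form_def monom_deg_def Poly_Mapping.lookup_add sum.distrib)
qed

lemma is_form_add: "is_form d p \<Longrightarrow> is_form d q \<Longrightarrow> is_form d (p + q)"
  using keys_add[of p q] by (auto simp: is_form_def)

lemma is_form_uminus: "is_form d p \<Longrightarrow> is_form d (- p)"
  by (simp add: is_form_def)

lemma is_form_diff: "is_form d p \<Longrightarrow> is_form d q \<Longrightarrow> is_form d (p - q)"
  using is_form_add[of d p "- q"] is_form_uminus[of d q] by simp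

lemma is_form_pascal_quartic:
  fixes f g :: "nat \<Rightarrow> cpoly5"
  assumes "h \<noteq> 0" and "\<And>i. i \<in> {1..5} \<Longrightarrow> h = f i + g i"
    and f: "\<And>i. i \<in> {1..5} \<Longrightarrow> is_form 1 (f i)"
    and g: "\<And>i. i \<in> {1..5} \<Longrightarrow> is_form 1 (g i)"
  shows "is_form 4 (pascal_quartic f g h)"
proof -
  have four: "is_form 4 (a * b * c * d)"
    if "is_form 1 a" "is_form 1 b" "is_form 1 c" "is_form 1 d" for a b c d
    using is_form_mult[OF is_form_mult[OF is_form_mult[OF that(1,2)] that(3)] that(4)]
    by (simp add: numeral_eq_Suc)
  have "pascal_quartic f g h =
    g 2 * g 3 * g 4 * g 5 - f 1 * g 3 * g 4 * g 5 + f 1 * f 2 * g 4 * g 5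
      - f 1 * f 2 * f 3 * g 5 + f 1 * f 2 * f 3 * f 4"
    by (rule pascal_quartic_explicit) (fact assms)+
  moreover have "is_form 4 \<dots>"
    by (intro is_form_add is_form_diff four f g) simp_all
  ultimately show ?thesis
    by simp
qed

end

theory Submission
  imports Defs
begin

text \<open>
  Let \<open>q\<close> be the quartic and evaluate at a vector \<open>v\<close> with \<open>f\<^sub>i(v) = g\<^sub>j(v) = 0\<close>.  The quintic
  \<open>h * q = f\<^sub>1\<dots>f\<^sub>5 + g\<^sub>1\<dots>g\<^sub>5\<close> vanishes there, which settles the case \<open>h(v) \<noteq> 0\<close>.  If \<open>h(v) = 0\<close>,
  then \<open>f\<^sub>i, f\<^sub>j, g\<^sub>i, g\<^sub>j\<close> all vanish at \<open>v\<close>; each summand of the explicit formula for \<open>q\<close> omits only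
  one of the five indices, hence has a factor with index \<open>i\<close> or \<open>j\<close>.
\<close>

text \<open>Exponents outside the support have coefficient zero. Enlarging the index set puts
  polynomials with different supports over one common sum, as additivity requires.\<close>

lemma eval_poly_superset:
  assumes "finite A" "Poly_Mapping.keys p \<subseteq> A"
  shows "eval_poly p x =
    (\<Sum>m\<in>A. Poly_Mapping.lookup p m * (\<Prod>i\<in>UNIV. (x $ i) ^ Poly_Mapping.lookup m i))"
  unfolding eval_poly_def
  by (rule sum.mono_neutral_left) (use assms in \<open>auto simp: in_keys_iff\<close>)

lemma eval_poly_zero [simp]: "eval_poly 0 x = 0"
  by (simp add: eval_poly_def)

lemma eval_poly_add [simp]: "eval_poly (p + q) x = eval_poly p x + eval_poly q x"
proof -
  have "finite (Poly_Mapping.keys p \<union> Poly_Mapping.keys q)"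
    by simp
  then show ?thesis
    using keys_add[of p q]
    by (simp add: eval_poly_superset[of "Poly_Mapping.keys p \<union> Poly_Mapping.keys q"]
        lookup_add distrib_right sum.distrib)
qed

lemma eval_poly_diff [simp]: "eval_poly (p - q) x = eval_poly p x - eval_poly q x"
  using eval_poly_add[of "p - q" q x] by simp

lemma eval_poly_sum: "eval_poly (\<Sum>a\<in>A. p a) x = (\<Sum>a\<in>A. eval_poly (p a) x)"
  by (induction A rule: infinite_finite_induct) simp_all

lemma eval_poly_single:
  "eval_poly (Poly_Mapping.single m c) x = c * (\<Prod>i\<in>UNIV. (x $ i) ^ Poly_Mapping.lookup m i)"
  by (subst eval_poly_superset[of "{m}"]) (auto simp: lookup_single)

lemma sum_single_keys:
  "(\<Sum>m\<in>Poly_Mapping.keys p. Poly_Mapping.single m (Poly_Mapping.lookup p m)) = p"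
  by (rule poly_mapping_eqI)
    (auto simp: lookup_sum lookup_single when_def in_keys_iff sum.delta)

text \<open>Expanding both factors into monomials leaves only products of monomials, where exponents
  add and so their values multiply.\<close>

lemma eval_poly_mult [simp]: "eval_poly (p * q) x = eval_poly p x * eval_poly q x"
proof -
  let ?s = "\<lambda>p m. Poly_Mapping.single m (Poly_Mapping.lookup p m)"
  have "p * q = (\<Sum>m\<in>Poly_Mapping.keys p. ?s p m) * (\<Sum>n\<in>Poly_Mapping.keys q. ?s q n)"
    by (simp only: sum_single_keys)
  also have "\<dots> = (\<Sum>m\<in>Poly_Mapping.keys p. \<Sum>n\<in>Poly_Mapping.keys q.
      Poly_Mapping.single (m + n) (Poly_Mapping.lookup p m * Poly_Mapping.lookup q n))"
    by (simp only: sum_product mult_single)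
  also have "eval_poly \<dots> x = eval_poly p x * eval_poly q x"
    unfolding eval_poly_def[of p] eval_poly_def[of q]
    by (simp add: eval_poly_sum eval_poly_single sum_product lookup_add power_add prod.distrib
        mult_ac)
  finally show ?thesis .
qed

lemma eval_pascal_quartic_eq_0:
  fixes f g :: "nat \<Rightarrow> cpoly5"
  assumes "h \<noteq> 0" and eq: "\<And>i. i \<in> {1..5} \<Longrightarrow> h = f i + g i"
    and ij: "i \<in> {1..5}" "j \<in> {1..5}" "i \<noteq> j"
    and f0: "eval_poly (f i) x = 0" and g0: "eval_poly (g j) x = 0"
  shows "eval_poly (pascal_quartic f g h) x = 0"
proof (cases "eval_poly h x = 0")
  case True
  have "eval_poly (f k) x + eval_poly (g k) x = 0" if "k \<in> {1..5}" for k
    using True eq[OF that] by (metis eval_poly_add)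
  from this[OF ij(1)] this[OF ij(2)]
  have zero: "eval_poly (g i) x = 0" "eval_poly (f j) x = 0"
    using f0 g0 by simp_all
  have "i = 1 \<or> i = 2 \<or> i = 3 \<or> i = 4 \<or> i = 5" "j = 1 \<or> j = 2 \<or> j = 3 \<or> j = 4 \<or> j = 5"
    using ij by auto
  \<comment> \<open>As \<open>i \<noteq> j\<close>, a summand that omits one of these indices still
    contains a factor with the other.\<close>
  then show ?thesis
    using f0 g0 zero ij(3) by (subst pascal_quartic_explicit[OF assms(1) eq]) auto
next
  case False
  have "i \<in> {1,2,3,4,5}" "j \<in> {1,2,3,4,5}"
    using ij by auto
  \<comment> \<open>\<open>f i\<close> kills the first quintic product and \<open>g j\<close> the
    second.\<close>
  then have "eval_poly (h * pascal_quartic f g h) x = 0"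
    using f0 g0 by (subst pascal_quartic_mult[OF assms(1) eq]) (auto simp: prod_1_5 simp del: One_nat_def)
  with False show ?thesis
    by simp
qed

theorem proposition2p2:
  fixes f g :: "nat \<Rightarrow> cpoly5" and h :: cpoly5
  assumes "\<And>i. i \<in> {1..5} \<Longrightarrow> is_form 1 (f i) \<and> f i \<noteq> 0"
    and "\<And>i. i \<in> {1..5} \<Longrightarrow> is_form 1 (g i) \<and> g i \<noteq> 0"
    and "is_form 1 h" and "h \<noteq> 0"
    and "\<And>i. i \<in> {1..5} \<Longrightarrow> h = f i + g i"
    and "\<And>i j. i \<in> {1..5} \<Longrightarrow> j \<in> {1..5} \<Longrightarrow> is_plane (Pi_plane f g i j)"
  shows "(\<forall>i\<in>{1..5}. Pi_plane f g i i \<subseteq> zero_locus h) \<and>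
    (\<forall>i\<in>{1..5}. \<forall>j\<in>{1..5}. i \<noteq> j \<longrightarrow> Pi_plane f g i j \<subseteq> pascal_threefold f g h)"
proof (intro conjI ballI impI)
  fix i :: nat assume "i \<in> {1..5}"
  then have "eval_poly h x = eval_poly (f i) x + eval_poly (g i) x" for x
    using assms(5) by (metis eval_poly_add)
  then show "Pi_plane f g i i \<subseteq> zero_locus h"
    by (auto simp: Pi_plane_def zero_locus_def)
next
  fix i j :: nat assume "i \<in> {1..5}" "j \<in> {1..5}" "i \<noteq> j"
  \<comment> \<open>Points are lines in the vector space, so the pointwise result is applied to
    every vector of the line, the origin included.\<close>
  then show "Pi_plane f g i j \<subseteq> pascal_threefold f g h"
    using eval_pascal_quartic_eq_0[of h f g i j, OF assms(4,5)]
    by (auto simp: Pi_plane_def pascal_threefold_def zero_locus_def)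
qed

end
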